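(* Let $n\ge1$, let $X_1,\dots,X_n$ be i.i.d. random variables taking values in $[0,1]$ with mean $\mathbb E X$, let $\alpha\in(0,1)$, and let $U$ be uniform on $[0,1]$, independent of $(X_1,\dots,X_n)$. Then the (possibly empty) interval $$\frac{\sum_{t=1}^n\lambda_tX_t}{\sum_{t=1}^n\lambda_t}\ \pm\ \left[\frac{\log(2/\alpha)+\log U+\sum_{t=1}^nv_t\,\psi(\lambda_t)}{\sum_{t=1}^n\lambda_t}\right]$$ is a $(1-\alpha)$-confidence interval for $\mathbb E X$, i.e. it contains $\mathbb E X$ with probability at least $1-\alpha$, where $\psi$, $v_t$ and $\lambda_t$ are as follows: $\psi(\lambda)=-\log(1-\lambda)-\lambda$ for $\lambda\in[0,1)$; $v_t=(X_t-\widehat\mu_{t-1})^2$ with $\widehat\mu_t=\frac{\frac12+\sum_{i=1}^tX_i}{t+1}$; and $$\lambda_t=\min\left(\sqrt{\frac{2\log(2/\alpha)}{\widehat\sigma_{t-1}^2\,n}},\ \frac12\right),\qquad \widehat\sigma_t^2=\frac{\frac14+\sum_{i=1}^t(X_i-\widehat\mu_i)^2}{t+1}.$$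
   Context: The notation $c\pm[w]$ denotes the interval $[c-w,c+w]$, which is empty if $w<0$. Empty sums are zero, so $\widehat\mu_0=1/2$ and $\widehat\sigma_0^2=1/4$. *)

theory Defs
  imports "HOL-Probability.Probability"
begin

text \<open>Independence of two random variables with possibly different codomain types
  (the library's \<open>indep_var\<close> needs both to have the same codomain type).\<close>

definition (in prob_space) indep_rvs ::
    "'b measure \<Rightarrow> ('a \<Rightarrow> 'b) \<Rightarrow> 'c measure \<Rightarrow> ('a \<Rightarrow> 'c) \<Rightarrow> bool" where
  "indep_rvs N Y K Z \<longleftrightarrow>
     random_variable N Y \<and> random_variable K Z \<and>
     indep_set {Y -` A \<inter> space M | A. A \<in> sets N} {Z -` B \<inter> space M | B. B \<in> sets K}"

definition pm_interval :: "real \<Rightarrow> real \<Rightarrow> real set" where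
  "pm_interval c w = {c - w .. c + w}"

definition psi :: "real \<Rightarrow> real" where
  "psi l = - ln (1 - l) - l"

text \<open>Below, \<open>x 1, \<dots>, x n\<close> is a sample path of the observations; \<open>x 0\<close> is never used.\<close>

definition mu_hat :: "(nat \<Rightarrow> real) \<Rightarrow> nat \<Rightarrow> real" where
  "mu_hat x t = (1/2 + (\<Sum>i=1..t. x i)) / (real t + 1)"

definition sigma2_hat :: "(nat \<Rightarrow> real) \<Rightarrow> nat \<Rightarrow> real" where
  "sigma2_hat x t = (1/4 + (\<Sum>i=1..t. (x i - mu_hat x i)\<^sup>2)) / (real t + 1)"

definition v_term :: "(nat \<Rightarrow> real) \<Rightarrow> nat \<Rightarrow> real" where
  "v_term x t = (x t - mu_hat x (t - 1))\<^sup>2"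

definition lam :: "nat \<Rightarrow> real \<Rightarrow> (nat \<Rightarrow> real) \<Rightarrow> nat \<Rightarrow> real" where
  "lam n \<alpha> x t = min (sqrt (2 * ln (2 / \<alpha>) / (sigma2_hat x (t - 1) * real n))) (1/2)"

text \<open>The argument \<open>u\<close> is the value of the uniform variable. At \<open>u = 0\<close> Isabelle has \<open>ln 0 = 0\<close>
  instead of \<open>- \<infinity>\<close>; under the uniform distribution this point has probability zero.\<close>

definition conf_interval :: "nat \<Rightarrow> real \<Rightarrow> (nat \<Rightarrow> real) \<Rightarrow> real \<Rightarrow> real set" where
  "conf_interval n \<alpha> x u =
     pm_interval
       ((\<Sum>t=1..n. lam n \<alpha> x t * x t) / (\<Sum>t=1..n. lam n \<alpha> x t))
       ((ln (2 / \<alpha>) + ln u + (\<Sum>t=1..n. v_term x t * psi (lam n \<alpha> x t)))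
          / (\<Sum>t=1..n. lam n \<alpha> x t))"

end

theory Submission
  imports Defs
begin

text \<open>Write \<open>\<mu>\<close> for the mean. Since \<open>\<bar>X\<^sub>t - \<mu>\<^sub>t\<^sub>-\<^sub>1\<bar> \<le> 1\<close>, Fan's inequality
  \<open>exp (\<lambda> \<xi> - \<xi>\<^sup>2 \<psi> \<lambda>) \<le> 1 + \<lambda> \<xi>\<close> (for the lower tail applied to \<open>\<xi> = \<mu>\<^sub>t\<^sub>-\<^sub>1 - X\<^sub>t\<close>) makes both
  \<open>exp (\<Sum>t\<le>k. \<plusminus>\<lambda>\<^sub>t (X\<^sub>t - \<mu>) - v\<^sub>t \<psi> \<lambda>\<^sub>t)\<close> nonnegative supermartingales started at 1,
  because the plug-in centre and the scale are predictable. If \<open>\<mu>\<close> is not covered, then one of the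
  two final values exceeds \<open>2 U / \<alpha>\<close>; integrating out the independent uniform \<open>U\<close> (a randomized
  Markov inequality) bounds each of these events by \<open>\<alpha>/2\<close>.\<close>

section \<open>Fan's inequality and the one-step exponential bound\<close>

text \<open>After taking logarithms, the two sides agree at \<open>l = 0\<close>, and the gap grows
  with \<open>l\<close>: its derivative at \<open>z\<close> is \<open>\<xi>\<^sup>2 * z\<close>
  times \<open>1 / (1 - z) - 1 / (1 + z * \<xi>)\<close>, which is nonnegative because
  \<open>\<xi> \<ge> -1\<close> gives \<open>1 - z \<le> 1 + z * \<xi>\<close>.\<close>

lemma exp_minus_square_psi_le:
  fixes l \<xi> :: real
  assumes l: "0 \<le> l" "l < 1" and \<xi>: "-1 \<le> \<xi>"
  shows "exp (l * \<xi> - \<xi>\<^sup>2 * psi l) \<le> 1 + l * \<xi>"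
proof -
  \<comment> \<open>The logarithm of the right side minus the exponent on the left, with
    \<open>\<xi>\<close> fixed.\<close>
  define G where "G = (\<lambda>l. ln (1 + l * \<xi>) - l * \<xi> + \<xi>\<^sup>2 * psi l)"
  have lower: "1 - z \<le> 1 + z * \<xi>" if "0 \<le> z" for z
    using mult_left_mono[OF \<xi> that] by simp
  have "G 0 \<le> G l"
  proof (rule DERIV_nonneg_imp_nondecreasing[OF l(1)])
    fix z assume z: "0 \<le> z" "z \<le> l"
    have pos: "1 - z > 0" "1 + z * \<xi> > 0" using lower[of z] z l by auto
    have "(G has_real_derivative (\<xi> / (1 + z * \<xi>) - \<xi> + \<xi>\<^sup>2 * (1 / (1 - z) - 1))) (at z)"
      unfolding G_def psi_def using pos by (auto intro!: derivative_eq_intros)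
    moreover have "\<xi> / (1 + z * \<xi>) - \<xi> = - (z * \<xi>\<^sup>2 / (1 + z * \<xi>))"
      using pos by (simp add: field_simps power2_eq_square)
    moreover have "1 / (1 - z) - 1 = z / (1 - z)"
      using pos by (simp add: field_simps)
    ultimately have "(G has_real_derivative (z * \<xi>\<^sup>2 * (1 / (1 - z) - 1 / (1 + z * \<xi>)))) (at z)"
      by (simp add: right_diff_distrib mult.commute)
    moreover have "1 / (1 + z * \<xi>) \<le> 1 / (1 - z)"
      using pos lower[of z] z by (intro divide_left_mono) auto
    ultimately show "\<exists>d. (G has_real_derivative d) (at z) \<and> 0 \<le> d"
      using z by (intro exI[of _ "z * \<xi>\<^sup>2 * (1 / (1 - z) - 1 / (1 + z * \<xi>))"] conjI) auto
  qed
  then have "l * \<xi> - \<xi>\<^sup>2 * psi l \<le> ln (1 + l * \<xi>)"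
    by (simp add: G_def psi_def)
  moreover have "1 + l * \<xi> > 0" using lower[of l] l by auto
  ultimately show ?thesis
    by (metis exp_le_cancel_iff exp_ln)
qed

text \<open>The centre \<open>m\<close> may differ from the mean. Splitting \<open>y - \<mu>\<close>
  into \<open>(y - m) + (m - \<mu>)\<close> and applying Fan's inequality to
  \<open>s * (y - m)\<close> leaves a bound affine in \<open>y\<close>. Its integral is at most 1
  because \<open>1 + a \<le> exp a\<close> cancels the factor
  \<open>exp (s * l * (m - \<mu>))\<close>.\<close>

lemma nn_integral_increment_le_1:
  fixes N :: "real measure" and l m s :: real
  assumes N: "prob_space N" "sets N = sets borel" and supp: "AE y in N. y \<in> {0..1}"
    and l: "0 \<le> l" "l < 1" and m: "m \<in> {0..1}" and s: "\<bar>s\<bar> = 1"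
  shows "(\<integral>\<^sup>+ y. ennreal (exp (s * l * (y - (LINT z|N. z)) - (y - m)\<^sup>2 * psi l)) \<partial>N) \<le> 1"
proof -
  interpret prob_space N by fact
  define \<mu> where "\<mu> = (LINT z|N. z)"
  have [measurable]: "(\<lambda>y. y) \<in> borel_measurable N"
    using measurable_ident_sets[OF N(2)] by (simp add: id_def)
  have int: "integrable N (\<lambda>y. y)"
    using supp by (intro integrable_const_bound[of _ 1]) auto
  define g where "g = (\<lambda>y. exp (s * l * (m - \<mu>)) * (1 + l * (s * (y - m))))"
  have s2: "s\<^sup>2 = 1" using s by (metis one_power2 power2_abs)
  have bound: "AE y in N. exp (s * l * (y - \<mu>) - (y - m)\<^sup>2 * psi l) \<le> g y"
    using supp
  proof eventually_elim
    case (elim y)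
    have ge: "-1 \<le> s * (y - m)" using elim m s by (auto simp: abs_if split: if_splits)
    have "exp (l * (s * (y - m)) - (s * (y - m))\<^sup>2 * psi l) \<le> 1 + l * (s * (y - m))"
      by (rule exp_minus_square_psi_le[OF l ge])
    moreover have "exp (s * l * (y - \<mu>) - (y - m)\<^sup>2 * psi l)
        = exp (s * l * (m - \<mu>)) * exp (l * (s * (y - m)) - (s * (y - m))\<^sup>2 * psi l)"
      by (simp add: s2 power_mult_distrib flip: exp_add) (simp add: algebra_simps)
    ultimately show ?case by (simp add: g_def)
  qed
  have int_g: "integrable N g" unfolding g_def using int by auto
  have g_nonneg: "AE y in N. 0 \<le> g y"
    using bound by eventually_elim (meson exp_ge_zero order_trans)
  have "(LINT y|N. g y) = exp (s * l * (m - \<mu>)) * (1 + l * (s * (\<mu> - m)))"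
    unfolding g_def using int by (simp add: prob_space \<mu>_def)
  also have "\<dots> \<le> exp (s * l * (m - \<mu>)) * exp (l * (s * (\<mu> - m)))"
    by (intro mult_left_mono exp_ge_add_one_self) simp
  also have "\<dots> = 1" by (simp add: algebra_simps flip: exp_add)
  finally have le1: "(LINT y|N. g y) \<le> 1" .
  have "(\<integral>\<^sup>+ y. ennreal (exp (s * l * (y - \<mu>) - (y - m)\<^sup>2 * psi l)) \<partial>N) \<le> (\<integral>\<^sup>+ y. ennreal (g y) \<partial>N)"
    using bound by (intro nn_integral_mono_AE) (auto intro: ennreal_leI)
  also have "\<dots> = ennreal (LINT y|N. g y)"
    by (rule nn_integral_eq_integral[OF int_g g_nonneg])
  also have "\<dots> \<le> 1" using le1 by simp
  finally show ?thesis by (simp add: \<mu>_def)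
qed

section \<open>Predictability and bounds of the plug-in estimates\<close>

lemma mu_hat_cong: "(\<And>i. 1 \<le> i \<Longrightarrow> i \<le> t \<Longrightarrow> x i = y i) \<Longrightarrow> mu_hat x t = mu_hat y t"
  using sum.cong[OF refl, of "{1..t}" x y] by (simp add: mu_hat_def)

lemma sigma2_hat_cong:
  assumes "\<And>i. 1 \<le> i \<Longrightarrow> i \<le> t \<Longrightarrow> x i = y i"
  shows "sigma2_hat x t = sigma2_hat y t"
proof -
  have "(\<Sum>i=1..t. (x i - mu_hat x i)\<^sup>2) = (\<Sum>i=1..t. (y i - mu_hat y i)\<^sup>2)"
  proof (rule sum.cong[OF refl])
    fix i assume "i \<in> {1..t}"
    then have "x i = y i" "mu_hat x i = mu_hat y i"
      using assms by (auto intro!: mu_hat_cong)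
    then show "(x i - mu_hat x i)\<^sup>2 = (y i - mu_hat y i)\<^sup>2" by simp
  qed
  then show ?thesis by (simp add: sigma2_hat_def)
qed

text \<open>Predictability of the scale: given the earlier observations, \<open>lam\<close> is a
  constant when the observation at time \<open>t\<close> is integrated out.\<close>

lemma lam_cong:
  "(\<And>i. 1 \<le> i \<Longrightarrow> i \<le> t - 1 \<Longrightarrow> x i = y i) \<Longrightarrow> lam n \<alpha> x t = lam n \<alpha> y t"
  unfolding lam_def using sigma2_hat_cong[of "t - 1" x y] by simp

lemma v_term_cong:
  assumes "\<And>i. 1 \<le> i \<Longrightarrow> i \<le> t \<Longrightarrow> x i = y i" "1 \<le> t"
  shows "v_term x t = v_term y t"
  unfolding v_term_def using mu_hat_cong[of "t - 1" x y] assms by simp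

text \<open>The estimate is an average of \<open>t + 1\<close> points of the unit interval, the
  extra one being 1/2. Hence the next observation lies within 1 of it, as Fan's inequality
  requires.\<close>

lemma mu_hat_bounds:
  assumes "\<And>i. 1 \<le> i \<Longrightarrow> i \<le> t \<Longrightarrow> x i \<in> {0..1}"
  shows "mu_hat x t \<in> {0..1}"
proof -
  have "(\<Sum>i=1..t. x i) \<ge> 0" using assms by (intro sum_nonneg) auto
  moreover have "(\<Sum>i=1..t. x i) \<le> real t"
    using sum_mono[of "{1..t}" x "\<lambda>_. 1"] assms by auto
  ultimately show ?thesis by (auto simp: mu_hat_def divide_simps)
qed

text \<open>The summand 1/4 keeps the variance estimate positive even on a constant path, so the
  quotient in \<open>lam\<close> never falls into division by zero.\<close>

lemma sigma2_hat_pos: "sigma2_hat x t > 0"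
  unfolding sigma2_hat_def
  by (intro divide_pos_pos add_pos_nonneg add_nonneg_pos sum_nonneg) auto

lemma lam_pos:
  assumes "n \<ge> 1" "0 < \<alpha>" "\<alpha> < 1"
  shows "lam n \<alpha> x t > 0"
  using assms sigma2_hat_pos[of x "t - 1"] by (auto simp: lam_def)

lemma lam_le_half: "lam n \<alpha> x t \<le> 1/2"
  by (simp add: lam_def)

section \<open>Measurability in the sample path and the exponential supermartingale\<close>

lemma measurable_mu_hat:
  "{1..t} \<subseteq> I \<Longrightarrow> (\<lambda>x. mu_hat x t) \<in> borel_measurable (Pi\<^sub>M I (\<lambda>_. borel))"
  unfolding mu_hat_def
  by (intro borel_measurable_divide borel_measurable_add borel_measurable_sum
      measurable_component_singleton borel_measurable_const) auto

lemma measurable_sigma2_hat: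
  "{1..t} \<subseteq> I \<Longrightarrow> (\<lambda>x. sigma2_hat x t) \<in> borel_measurable (Pi\<^sub>M I (\<lambda>_. borel))"
  unfolding sigma2_hat_def
  by (intro borel_measurable_divide borel_measurable_add borel_measurable_sum
      borel_measurable_power borel_measurable_diff measurable_mu_hat
      measurable_component_singleton borel_measurable_const) auto

lemma measurable_lam:
  assumes "{1..t - 1} \<subseteq> I"
  shows "(\<lambda>x. lam n \<alpha> x t) \<in> borel_measurable (Pi\<^sub>M I (\<lambda>_. borel))"
proof -
  note [measurable] = measurable_sigma2_hat[OF assms]
  show ?thesis unfolding lam_def by measurable
qed

lemma measurable_v_term:
  assumes "t \<ge> 1" "{1..t} \<subseteq> I"
  shows "(\<lambda>x. v_term x t) \<in> borel_measurable (Pi\<^sub>M I (\<lambda>_. borel))"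
proof -
  have "{1..t - 1} \<subseteq> {1..t}" by auto
  with assms have sub: "{1..t - 1} \<subseteq> I" and t: "t \<in> I"
    by (blast intro: order_trans, auto)
  note [measurable] = measurable_mu_hat[OF sub] measurable_component_singleton[OF t]
  show ?thesis unfolding v_term_def by measurable
qed

text \<open>The sign \<open>s = \<plusminus>1\<close> selects the upper or the lower tail.\<close>

definition log_increment :: "nat \<Rightarrow> real \<Rightarrow> real \<Rightarrow> real \<Rightarrow> (nat \<Rightarrow> real) \<Rightarrow> nat \<Rightarrow> real" where
  "log_increment n \<alpha> \<mu> s x t = s * lam n \<alpha> x t * (x t - \<mu>) - v_term x t * psi (lam n \<alpha> x t)"

lemma measurable_log_increment:
  assumes "t \<ge> 1" "{1..t} \<subseteq> I"
  shows "(\<lambda>x. log_increment n \<alpha> \<mu> s x t) \<in> borel_measurable (Pi\<^sub>M I (\<lambda>_. borel))"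
proof -
  have "{1..t - 1} \<subseteq> {1..t}" by auto
  with assms have sub: "{1..t - 1} \<subseteq> I" and t: "t \<in> I"
    by (blast intro: order_trans, auto)
  note [measurable] = measurable_lam[OF sub] measurable_v_term[OF assms]
    measurable_component_singleton[OF t]
  show ?thesis unfolding log_increment_def psi_def by measurable
qed

lemma log_increment_cong:
  assumes "\<And>i. 1 \<le> i \<Longrightarrow> i \<le> t \<Longrightarrow> x i = y i" "1 \<le> t"
  shows "log_increment n \<alpha> \<mu> s x t = log_increment n \<alpha> \<mu> s y t"
  unfolding log_increment_def
  using assms lam_cong[of t x y n \<alpha>] v_term_cong[of t x y] by auto

lemma measurable_supermartingale:
  "(\<lambda>x. \<Prod>t=1..k. ennreal (exp (log_increment n \<alpha> \<mu> s x t)) * indicator {0..1} (x t))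
    \<in> borel_measurable (Pi\<^sub>M {1..k} (\<lambda>_. borel))"
proof (intro borel_measurable_prod_ennreal borel_measurable_times_ennreal)
  fix t assume t: "t \<in> {1..k}"
  then have incr: "t \<ge> 1" "{1..t} \<subseteq> {1..k}" by auto
  show "(\<lambda>x. ennreal (exp (log_increment n \<alpha> \<mu> s x t))) \<in> borel_measurable (Pi\<^sub>M {1..k} (\<lambda>_. borel))"
    using measurable_log_increment[OF incr] by (rule measurable_compose) measurable
  show "(\<lambda>x. indicator {0..1 :: real} (x t) :: ennreal) \<in> borel_measurable (Pi\<^sub>M {1..k} (\<lambda>_. borel))"
    using measurable_component_singleton[OF t]
    by (rule measurable_compose) (rule borel_measurable_indicator, simp)
qed

text \<open>The indicators avoid carrying an almost-everywhere statement on the product space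
  through the induction.\<close>

lemma nn_integral_supermartingale_le_1:
  fixes N :: "real measure" and s :: real
  assumes N: "prob_space N" "sets N = sets borel" and supp: "AE y in N. y \<in> {0..1}"
    and n: "n \<ge> 1" and \<alpha>: "0 < \<alpha>" "\<alpha> < 1" and s: "\<bar>s\<bar> = 1"
  shows "(\<integral>\<^sup>+ x. (\<Prod>t=1..k. ennreal (exp (log_increment n \<alpha> (LINT z|N. z) s x t)) * indicator {0..1} (x t))
           \<partial>Pi\<^sub>M {1..k} (\<lambda>_. N)) \<le> 1"
proof (induction k)
  case 0
  show ?case by (simp add: PiM_empty)
next
  case (Suc k)
  interpret N: prob_space N by fact
  interpret product_sigma_finite "\<lambda>_. N" by unfold_locales
  define F where "F = (\<lambda>x t. ennreal (exp (log_increment n \<alpha> (LINT z|N. z) s x t)) * indicator {0..1} (x t))"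
  have F_meas: "(\<lambda>x. \<Prod>t=1..j. F x t) \<in> borel_measurable (Pi\<^sub>M {1..j} (\<lambda>_. N))" for j
  proof -
    have "sets (Pi\<^sub>M {1..j} (\<lambda>_. N)) = sets (Pi\<^sub>M {1..j} (\<lambda>_. borel))"
      by (intro sets_PiM_cong) (auto simp: N)
    then show ?thesis
      unfolding F_def using measurable_supermartingale by (subst measurable_cong_sets[OF _ refl])
  qed
  \<comment> \<open>Changing the last coordinate leaves the earlier factors alone, so their product
    is a constant in the inner integral.\<close>
  have F_upd: "F (x(Suc k := y)) t = F x t" if "t \<in> {1..k}" for x y t
    using that log_increment_cong[of t "x(Suc k := y)" x] by (auto simp: F_def)
  have prod_upd: "(\<Prod>t=1..k. F (x(Suc k := y)) t) = (\<Prod>t=1..k. F x t)" for x y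
    by (intro prod.cong F_upd refl)
  have ins: "{1..Suc k} = insert (Suc k) {1..k}" by auto
  \<comment> \<open>Integrating the newest coordinate first plays the role of conditioning on the
    first \<open>k\<close> observations.\<close>
  have "(\<integral>\<^sup>+ x. (\<Prod>t=1..Suc k. F x t) \<partial>Pi\<^sub>M {1..Suc k} (\<lambda>_. N))
      = (\<integral>\<^sup>+ x. (\<integral>\<^sup>+ y. (\<Prod>t=1..Suc k. F (x(Suc k := y)) t) \<partial>N) \<partial>Pi\<^sub>M {1..k} (\<lambda>_. N))"
    using F_meas[of "Suc k"] unfolding ins
    by (subst product_nn_integral_insert) auto
  also have "\<dots> = (\<integral>\<^sup>+ x. (\<integral>\<^sup>+ y. (\<Prod>t=1..k. F x t) * F (x(Suc k := y)) (Suc k) \<partial>N) \<partial>Pi\<^sub>M {1..k} (\<lambda>_. N))"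
    by (simp add: prod_upd[simplified])
  also have "\<dots> \<le> (\<integral>\<^sup>+ x. (\<Prod>t=1..k. F x t) \<partial>Pi\<^sub>M {1..k} (\<lambda>_. N))"
  proof (rule nn_integral_mono)
    fix x :: "nat \<Rightarrow> real"
    show "(\<integral>\<^sup>+ y. (\<Prod>t=1..k. F x t) * F (x(Suc k := y)) (Suc k) \<partial>N) \<le> (\<Prod>t=1..k. F x t)"
    \<comment> \<open>Off the unit cube some earlier indicator is 0 and both sides vanish. On it
      \<open>mu_hat x k\<close> lies in the unit interval, so the one-step bound applies.\<close>
    proof (cases "\<forall>t\<in>{1..k}. x t \<in> {0..1}")
      case False
      then obtain t where t: "t \<in> {1..k}" and "x t \<notin> {0..1}" by blast
      then have "F x t = 0" by (simp add: F_def)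
      then have "(\<Prod>t=1..k. F x t) = 0" using t by (intro prod_zero) auto
      then show ?thesis by (simp only: mult_zero_left nn_integral_const)
    next
      case True
      define l where "l = lam n \<alpha> x (Suc k)"
      define m where "m = mu_hat x k"
      have m: "m \<in> {0..1}" unfolding m_def using True by (intro mu_hat_bounds) auto
      have l: "0 \<le> l" "l < 1"
        using lam_pos[OF n \<alpha>, of x "Suc k"] lam_le_half[of n \<alpha> x "Suc k"] by (auto simp: l_def)
      have upd: "lam n \<alpha> (x(Suc k := y)) (Suc k) = l" "mu_hat (x(Suc k := y)) k = m" for y
        unfolding l_def m_def by (auto intro!: lam_cong mu_hat_cong)
      have [measurable]: "(\<lambda>y. y) \<in> borel_measurable N"
        using measurable_ident_sets[OF N(2)] by (simp add: id_def)
      \<comment> \<open>The indicator of the newest coordinate is bounded by 1; the one-step bound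
        uses \<open>supp\<close> instead.\<close>
      have "(\<integral>\<^sup>+ y. (\<Prod>t=1..k. F x t) * F (x(Suc k := y)) (Suc k) \<partial>N)
          \<le> (\<integral>\<^sup>+ y. (\<Prod>t=1..k. F x t)
                * ennreal (exp (s * l * (y - (LINT z|N. z)) - (y - m)\<^sup>2 * psi l)) \<partial>N)"
        by (intro nn_integral_mono mult_left_mono)
          (auto simp: F_def log_increment_def v_term_def upd indicator_def)
      also have "\<dots> = (\<Prod>t=1..k. F x t)
                * (\<integral>\<^sup>+ y. ennreal (exp (s * l * (y - (LINT z|N. z)) - (y - m)\<^sup>2 * psi l)) \<partial>N)"
        by (rule nn_integral_cmult) measurable
      also have "\<dots> \<le> (\<Prod>t=1..k. F x t) * 1"
        by (intro mult_left_mono nn_integral_increment_le_1[OF N supp l m s]) auto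
      finally show ?thesis by simp
    qed
  qed
  also have "\<dots> \<le> 1" using Suc.IH by (simp add: F_def)
  finally show ?case by (simp add: F_def)
qed

section \<open>Independence and the randomized Markov inequality\<close>

text \<open>Independence gives the product value on measurable rectangles, and these determine the
  joint law.\<close>

lemma (in prob_space) indep_rvs_distr_pair:
  assumes "indep_rvs N Y K Z"
  shows "distr M (N \<Otimes>\<^sub>M K) (\<lambda>\<omega>. (Y \<omega>, Z \<omega>)) = distr M N Y \<Otimes>\<^sub>M distr M K Z"
proof -
  have [measurable]: "Y \<in> measurable M N" "Z \<in> measurable M K"
    using assms by (auto simp: indep_rvs_def)
  have ind: "indep_set {Y -` A \<inter> space M | A. A \<in> sets N} {Z -` B \<inter> space M | B. B \<in> sets K}"
    using assms by (simp add: indep_rvs_def)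
  interpret Y: prob_space "distr M N Y" by (rule prob_space_distr) simp
  interpret Z: prob_space "distr M K Z" by (rule prob_space_distr) simp
  show ?thesis
  proof (rule pair_measure_eqI[symmetric])
    fix A B assume AB: "A \<in> sets (distr M N Y)" "B \<in> sets (distr M K Z)"
    then have [measurable]: "A \<in> sets N" "B \<in> sets K" by auto
    have "emeasure (distr M (N \<Otimes>\<^sub>M K) (\<lambda>\<omega>. (Y \<omega>, Z \<omega>))) (A \<times> B)
        = emeasure M ((Y -` A \<inter> space M) \<inter> (Z -` B \<inter> space M))"
      by (subst emeasure_distr) (auto intro!: arg_cong[where f="emeasure M"])
    also have "\<dots> = emeasure M (Y -` A \<inter> space M) * emeasure M (Z -` B \<inter> space M)"
    proof -
      have "prob ((Y -` A \<inter> space M) \<inter> (Z -` B \<inter> space M))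
          = prob (Y -` A \<inter> space M) * prob (Z -` B \<inter> space M)"
        using AB by (intro indep_setD[OF ind]) auto
      then show ?thesis by (simp add: emeasure_eq_measure ennreal_mult)
    qed
    finally show "emeasure (distr M N Y) A * emeasure (distr M K Z) B
        = emeasure (distr M (N \<Otimes>\<^sub>M K) (\<lambda>\<omega>. (Y \<omega>, Z \<omega>))) (A \<times> B)"
      by (simp add: emeasure_distr)
  qed (auto intro: Y.sigma_finite_measure_axioms Z.sigma_finite_measure_axioms)
qed

text \<open>Only an inequality, since the left side stays 1 once \<open>c\<close> exceeds 1.\<close>

lemma emeasure_uniform_atMost_le:
  fixes c :: real
  assumes "0 \<le> c"
  shows "emeasure (uniform_measure lborel {0..1}) {..c} \<le> ennreal c"
proof -
  have "emeasure (uniform_measure lborel {0..1}) {..c} = emeasure lborel ({0..1::real} \<inter> {..c})"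
    by (subst emeasure_uniform_measure) (auto simp: divide_ennreal_def)
  also have "\<dots> \<le> emeasure lborel {0..c}" by (intro emeasure_mono) auto
  also have "\<dots> = ennreal c" using assms by simp
  finally show ?thesis .
qed

text \<open>For fixed \<open>y\<close> the uniform variable falls below \<open>f y\<close> with
  probability at most \<open>f y\<close>; independence allows integrating this over the law of
  \<open>Y\<close>. The uniform threshold replaces the constant 1 of Markov's inequality, at no cost
  in the bound.\<close>

lemma (in prob_space) randomized_Markov:
  fixes U :: "'a \<Rightarrow> real" and f :: "'b \<Rightarrow> real"
  assumes U: "distr M borel U = uniform_measure lborel {0..1}"
    and ind: "indep_rvs borel U K Y"
    and f [measurable]: "f \<in> borel_measurable K" and nonneg: "\<And>y. 0 \<le> f y"
  shows "emeasure M {\<omega> \<in> space M. U \<omega> \<le> f (Y \<omega>)} \<le> (\<integral>\<^sup>+ y. ennreal (f y) \<partial>distr M K Y)"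
proof -
  have [measurable]: "U \<in> borel_measurable M" "Y \<in> measurable M K"
    using ind by (auto simp: indep_rvs_def)
  interpret U: prob_space "distr M borel U" by (rule prob_space_distr) simp
  interpret Y: prob_space "distr M K Y" by (rule prob_space_distr) simp
  interpret pair_sigma_finite "distr M borel U" "distr M K Y" ..
  define S where "S = {p \<in> space (borel \<Otimes>\<^sub>M K). fst p \<le> f (snd p)}"
  have S [measurable]: "S \<in> sets (borel \<Otimes>\<^sub>M K)" unfolding S_def by measurable
  have "emeasure M {\<omega> \<in> space M. U \<omega> \<le> f (Y \<omega>)}
      = emeasure (distr M (borel \<Otimes>\<^sub>M K) (\<lambda>\<omega>. (U \<omega>, Y \<omega>))) S"
    using measurable_space[OF \<open>Y \<in> measurable M K\<close>]
    by (subst emeasure_distr)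
      (auto simp: S_def space_pair_measure intro!: arg_cong[where f="emeasure M"])
  also have "\<dots> = (\<integral>\<^sup>+ y. emeasure (distr M borel U) ((\<lambda>u. (u, y)) -` S) \<partial>distr M K Y)"
    by (subst indep_rvs_distr_pair[OF ind], subst emeasure_pair_measure_alt2) auto
  also have "\<dots> \<le> (\<integral>\<^sup>+ y. ennreal (f y) \<partial>distr M K Y)"
  proof (rule nn_integral_mono)
    fix y assume "y \<in> space (distr M K Y)"
    then have "(\<lambda>u. (u, y)) -` S = {..f y}" by (auto simp: S_def space_pair_measure)
    then show "emeasure (distr M borel U) ((\<lambda>u. (u, y)) -` S) \<le> ennreal (f y)"
      using emeasure_uniform_atMost_le[OF nonneg] by (simp add: U)
  qed
  finally show ?thesis .
qed

section \<open>Coverage of the interval\<close>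

text \<open>One of the two endpoint inequalities fails, also when the interval is empty. Multiplied
  by the positive sum of the \<open>lam\<close>, a failure at the lower endpoint gives
  \<open>s = 1\<close> and one at the upper endpoint gives \<open>s = -1\<close>.\<close>

lemma not_in_conf_intervalD:
  assumes n: "n \<ge> 1" and \<alpha>: "0 < \<alpha>" "\<alpha> < 1" and u: "0 < u"
    and out: "\<mu> \<notin> conf_interval n \<alpha> x u"
  obtains s where "s \<in> {1, -1}" "u \<le> \<alpha> / 2 * exp (\<Sum>t=1..n. log_increment n \<alpha> \<mu> s x t)"
proof -
  define L where "L = (\<Sum>t=1..n. lam n \<alpha> x t)"
  define S where "S = (\<Sum>t=1..n. lam n \<alpha> x t * x t)"
  define W where "W = (\<Sum>t=1..n. v_term x t * psi (lam n \<alpha> x t))"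
  have L: "L > 0" unfolding L_def using n lam_pos[OF n \<alpha>] by (intro sum_pos) auto
  have sum_eq: "(\<Sum>t=1..n. log_increment n \<alpha> \<mu> s x t) = s * (S - L * \<mu>) - W" for s
    unfolding log_increment_def S_def L_def W_def
    by (simp add: sum_subtractf sum_distrib_left sum_distrib_right right_diff_distrib mult.assoc)
  have "\<not> (S / L - (ln (2 / \<alpha>) + ln u + W) / L \<le> \<mu>
        \<and> \<mu> \<le> S / L + (ln (2 / \<alpha>) + ln u + W) / L)"
    using out by (auto simp: conf_interval_def pm_interval_def S_def L_def W_def)
  then have "S - L * \<mu> - W > ln (2 / \<alpha>) + ln u \<or> - (S - L * \<mu>) - W > ln (2 / \<alpha>) + ln u"
    using L by (simp add: field_simps) linarith
  then obtain s :: real where s: "s \<in> {1, -1}"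
    and gt: "(\<Sum>t=1..n. log_increment n \<alpha> \<mu> s x t) > ln (2 / \<alpha>) + ln u"
    unfolding sum_eq by (metis insertCI mult_1 mult_minus1)
  \<comment> \<open>Positivity of \<open>u\<close> is what makes \<open>exp\<close> undo
    \<open>ln u\<close>.\<close>
  have "2 / \<alpha> * u = exp (ln (2 / \<alpha>) + ln u)" using \<alpha> u by (simp add: exp_add)
  also have "\<dots> \<le> exp (\<Sum>t=1..n. log_increment n \<alpha> \<mu> s x t)" using gt by simp
  finally have "u \<le> \<alpha> / 2 * exp (\<Sum>t=1..n. log_increment n \<alpha> \<mu> s x t)"
    using \<alpha> by (simp add: field_simps)
  with s that show ?thesis by blast
qed

theorem mainTheorem16:
  fixes M :: "'a measure" and X :: "nat \<Rightarrow> 'a \<Rightarrow> real" and U :: "'a \<Rightarrow> real"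
    and n :: nat and \<alpha> :: real
  assumes "prob_space M"
    and "n \<ge> 1"
    and "prob_space.indep_vars M (\<lambda>_. borel) X {1..n}"
    and "\<And>i. i \<in> {1..n} \<Longrightarrow> distr M borel (X i) = distr M borel (X 1)"
    and "\<And>i \<omega>. i \<in> {1..n} \<Longrightarrow> \<omega> \<in> space M \<Longrightarrow> X i \<omega> \<in> {0..1}"
    and "0 < \<alpha>" and "\<alpha> < 1"
    and "distr M borel U = uniform_measure lborel {0..1}"
    and "prob_space.indep_rvs M borel U
           (Pi\<^sub>M {1..n} (\<lambda>_. borel)) (\<lambda>\<omega>. \<lambda>i\<in>{1..n}. X i \<omega>)"
  shows "measure M {\<omega> \<in> space M.
           prob_space.expectation M (X 1) \<in> conf_interval n \<alpha> (\<lambda>t. X t \<omega>) (U \<omega>)} \<ge> 1 - \<alpha>"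
proof -
  interpret prob_space M by fact
  note n = assms(2) and \<alpha> = assms(6,7) and X01 = assms(5) and unif = assms(8) and ind = assms(9)
  define N where "N = distr M borel (X 1)"
  define K where "K = Pi\<^sub>M {1..n} (\<lambda>_. borel :: real measure)"
  \<comment> \<open>Elements of the product space are undefined outside \<open>{1..n}\<close>, hence
    the restriction. The interval reads the unrestricted path; the congruence lemmas identify the
    two.\<close>
  define Y where "Y = (\<lambda>\<omega>. \<lambda>i\<in>{1..n}. X i \<omega>)"
  define \<mu> where "\<mu> = expectation (X 1)"
  have X_meas: "X i \<in> borel_measurable M" if "i \<in> {1..n}" for i
    using assms(3) that by (auto simp: indep_vars_def2)
  have X1 [measurable]: "X 1 \<in> borel_measurable M" using n by (intro X_meas) simp
  have U_meas [measurable]: "U \<in> borel_measurable M" and Y_meas [measurable]: "Y \<in> measurable M K"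
    using ind by (auto simp: indep_rvs_def Y_def K_def)
  have N: "prob_space N" "sets N = sets borel" unfolding N_def by (rule prob_space_distr[OF X1], simp)
  have supp: "AE y in N. y \<in> {0..1}"
    unfolding N_def using X01[of 1] n X1 by (subst AE_distr_iff) auto
  have mean: "(LINT z|N. z) = \<mu>" unfolding N_def \<mu>_def using X1 by (subst integral_distr) auto
  \<comment> \<open>Independence makes the joint law a product of the marginals, and these all equal
    \<open>N\<close>.\<close>
  have law: "distr M K Y = Pi\<^sub>M {1..n} (\<lambda>_. N)"
  proof -
    have "distr M K Y = Pi\<^sub>M {1..n} (\<lambda>i. distr M borel (X i))"
      unfolding K_def Y_def
      using assms(3) n X_meas by (subst (asm) indep_vars_iff_distr_eq_PiM') auto
    also have "\<dots> = Pi\<^sub>M {1..n} (\<lambda>_. N)"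
      unfolding N_def by (intro PiM_cong refl assms(4))
    finally show ?thesis .
  qed
  \<comment> \<open>The threshold for \<open>U\<close>: \<open>\<alpha> / 2\<close> times the final
    supermartingale value, real-valued as \<open>randomized_Markov\<close> expects. The indicators
    match the integrand bounded by induction.\<close>
  define R where "R = (\<lambda>s x. \<alpha> / 2 * exp (\<Sum>t=1..n. log_increment n \<alpha> \<mu> s x t)
                        * (\<Prod>t=1..n. indicator {0..1} (x t)))"
  have R_meas [measurable]: "R s \<in> borel_measurable K" for s
  proof -
    have "(\<lambda>x. log_increment n \<alpha> \<mu> s x t) \<in> borel_measurable K" if "t \<in> {1..n}" for t
      using that unfolding K_def by (intro measurable_log_increment) auto
    then have [measurable]: "(\<lambda>x. \<Sum>t=1..n. log_increment n \<alpha> \<mu> s x t) \<in> borel_measurable K"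
      by (rule borel_measurable_sum)
    have "(\<lambda>x. indicator {0..1} (x t) :: real) \<in> borel_measurable K" if "t \<in> {1..n}" for t
      using measurable_component_singleton[OF that] unfolding K_def
      by (rule measurable_compose) (rule borel_measurable_indicator, simp)
    then have [measurable]: "(\<lambda>x. \<Prod>t=1..n. indicator {0..1} (x t) :: real) \<in> borel_measurable K"
      by (rule borel_measurable_prod)
    show ?thesis unfolding R_def by measurable
  qed
  have R_nonneg: "0 \<le> R s x" for s x
    unfolding R_def using \<alpha> by (intro mult_nonneg_nonneg prod_nonneg) auto
  have tail: "emeasure M {\<omega> \<in> space M. U \<omega> \<le> R s (Y \<omega>)} \<le> ennreal (\<alpha> / 2)" if s: "\<bar>s\<bar> = 1" for s
  proof -
    have R_eq: "ennreal (R s x) = ennreal (\<alpha> / 2)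
        * (\<Prod>t=1..n. ennreal (exp (log_increment n \<alpha> \<mu> s x t)) * indicator {0..1} (x t))" for x
    proof -
      have "R s x = \<alpha> / 2 * (\<Prod>t=1..n. exp (log_increment n \<alpha> \<mu> s x t) * indicator {0..1} (x t))"
        by (simp only: R_def exp_sum[OF finite_atLeastAtMost] prod.distrib mult.assoc)
      also have "ennreal \<dots> = ennreal (\<alpha> / 2)
          * (\<Prod>t=1..n. ennreal (exp (log_increment n \<alpha> \<mu> s x t) * indicator {0..1} (x t)))"
        using \<alpha> by (subst prod_ennreal, simp) (intro ennreal_mult prod_nonneg, auto)
      finally show ?thesis by (simp add: ennreal_mult ennreal_indicator)
    qed
    have "emeasure M {\<omega> \<in> space M. U \<omega> \<le> R s (Y \<omega>)} \<le> (\<integral>\<^sup>+ y. ennreal (R s y) \<partial>distr M K Y)"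
      using ind by (intro randomized_Markov[OF unif _ R_meas R_nonneg]) (simp add: K_def Y_def)
    also have "\<dots> = ennreal (\<alpha> / 2) * (\<integral>\<^sup>+ x. (\<Prod>t=1..n.
        ennreal (exp (log_increment n \<alpha> \<mu> s x t)) * indicator {0..1} (x t)) \<partial>distr M K Y)"
      unfolding R_eq
      using measurable_supermartingale by (intro nn_integral_cmult) (simp add: K_def)
    also have "\<dots> \<le> ennreal (\<alpha> / 2) * 1"
      using nn_integral_supermartingale_le_1[OF N supp n \<alpha> s, of n]
      unfolding law mean by (intro mult_left_mono) auto
    finally show ?thesis by simp
  qed
  define Good where "Good = {\<omega> \<in> space M. \<mu> \<in> conf_interval n \<alpha> (\<lambda>t. X t \<omega>) (U \<omega>)}"
  define B where "B = (\<lambda>s. {\<omega> \<in> space M. U \<omega> \<le> R s (Y \<omega>)})"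
  have B_sets [measurable]: "B s \<in> sets M" for s unfolding B_def by measurable
  \<comment> \<open>Needed for \<open>prob_compl\<close>, which turns the bound on the complement
    into the coverage bound.\<close>
  have Good_sets: "Good \<in> sets M"
  proof -
    have lam_meas: "(\<lambda>\<omega>. lam n \<alpha> (\<lambda>t. X t \<omega>) t) \<in> borel_measurable M" if t: "t \<in> {1..n}" for t
    proof -
      have "(\<lambda>x. lam n \<alpha> x t) \<in> borel_measurable K"
        unfolding K_def using t by (intro measurable_lam) auto
      moreover have "lam n \<alpha> (\<lambda>t. X t \<omega>) t = lam n \<alpha> (Y \<omega>) t" for \<omega>
        using t by (intro lam_cong) (auto simp: Y_def)
      ultimately show ?thesis using measurable_compose[OF Y_meas] by simp
    qed
    have v_meas: "(\<lambda>\<omega>. v_term (\<lambda>t. X t \<omega>) t) \<in> borel_measurable M" if t: "t \<in> {1..n}" for t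
    proof -
      have "(\<lambda>x. v_term x t) \<in> borel_measurable K"
        unfolding K_def using t by (intro measurable_v_term) auto
      moreover have "v_term (\<lambda>t. X t \<omega>) t = v_term (Y \<omega>) t" for \<omega>
        using t by (intro v_term_cong) (auto simp: Y_def)
      ultimately show ?thesis using measurable_compose[OF Y_meas] by simp
    qed
    have sums [measurable]:
      "(\<lambda>\<omega>. \<Sum>t=1..n. lam n \<alpha> (\<lambda>t. X t \<omega>) t) \<in> borel_measurable M"
      "(\<lambda>\<omega>. \<Sum>t=1..n. lam n \<alpha> (\<lambda>t. X t \<omega>) t * X t \<omega>) \<in> borel_measurable M"
      "(\<lambda>\<omega>. \<Sum>t=1..n. v_term (\<lambda>t. X t \<omega>) t * psi (lam n \<alpha> (\<lambda>t. X t \<omega>) t)) \<in> borel_measurable M"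
      unfolding psi_def
      by (intro borel_measurable_sum borel_measurable_times borel_measurable_diff
          borel_measurable_uminus borel_measurable_ln borel_measurable_const lam_meas v_meas X_meas; assumption)+
    show ?thesis
      unfolding Good_def conf_interval_def pm_interval_def atLeastAtMost_iff by measurable
  qed
  \<comment> \<open>Discards the null event where \<open>ln\<close> would take its default value at
    0; this is why the inclusion below holds only almost everywhere.\<close>
  have U_pos: "AE \<omega> in M. U \<omega> > 0"
  proof -
    have "AE u in distr M borel U. u > 0"
      unfolding unif
      by (rule AE_uniform_measureI) (use AE_lborel_singleton[of "0::real"] in auto)
    then show ?thesis by (subst (asm) AE_distr_iff) auto
  qed
  have cover: "\<omega> \<in> B 1 \<union> B (-1)" if bad: "\<omega> \<in> space M - Good" and pos: "U \<omega> > 0" for \<omega>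
  proof -
    have \<omega>: "\<omega> \<in> space M" and out: "\<mu> \<notin> conf_interval n \<alpha> (\<lambda>t. X t \<omega>) (U \<omega>)"
      using bad by (auto simp: Good_def)
    obtain s where s: "s \<in> {1, -1}"
      and le: "U \<omega> \<le> \<alpha> / 2 * exp (\<Sum>t=1..n. log_increment n \<alpha> \<mu> s (\<lambda>t. X t \<omega>) t)"
      by (rule not_in_conf_intervalD[OF n \<alpha> pos out])
    have "(\<Sum>t=1..n. log_increment n \<alpha> \<mu> s (\<lambda>t. X t \<omega>) t) = (\<Sum>t=1..n. log_increment n \<alpha> \<mu> s (Y \<omega>) t)"
      by (intro sum.cong refl log_increment_cong) (auto simp: Y_def)
    \<comment> \<open>On actual observations all indicators are 1, so including them in
      \<open>R\<close> does not shrink the tail events.\<close>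
    moreover have "(\<Prod>t=1..n. indicator {0..1} (Y \<omega> t)) = (1 :: real)"
      using X01 \<omega> by (intro prod.neutral) (auto simp: Y_def)
    ultimately have "\<omega> \<in> B s" using le \<omega> by (simp add: B_def R_def)
    then show ?thesis using s by auto
  qed
  have "emeasure M (space M - Good) \<le> emeasure M (B 1 \<union> B (-1))"
  proof (rule emeasure_mono_AE)
    show "AE \<omega> in M. \<omega> \<in> space M - Good \<longrightarrow> \<omega> \<in> B 1 \<union> B (-1)"
      using U_pos by eventually_elim (use cover in blast)
  qed measurable
  also have "\<dots> \<le> emeasure M (B 1) + emeasure M (B (-1))"
    by (intro emeasure_subadditive) auto
  also have "\<dots> \<le> ennreal (\<alpha> / 2) + ennreal (\<alpha> / 2)"
    unfolding B_def by (intro add_mono tail) auto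
  also have "\<dots> = ennreal \<alpha>" using \<alpha> by (simp flip: ennreal_plus)
  finally have "measure M (space M - Good) \<le> \<alpha>"
    using \<alpha> by (simp add: emeasure_eq_measure)
  then show ?thesis
    using prob_compl[OF Good_sets] by (simp add: Good_def \<mu>_def)
qed

end
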